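(* Let $\alpha_n:=\sqrt{\frac{n+2}{n+3}}$ ($n\ge0$), let $\alpha\equiv\{\alpha_n\}_{n=0}^\infty$, let $\ell\ge1$ be an integer and let $x>0$. Then $W_{\alpha(\sqrt x)(\ell:0)}$ is positively quadratically hyponormal if and only if $$\begin{cases} x\le \dfrac{(\ell+1)^2}{2(2\ell+1)} & \text{if } \ell=1,2,\\[2mm] x\le \dfrac{(\ell+1)^2(1+7\ell+34\ell^2+44\ell^3)}{2(1+9\ell+45\ell^2+99\ell^3+94\ell^4)} & \text{if } \ell\ge3.\end{cases}$$
   Context: For a bounded sequence of positive numbers (weights) $\omega=\{\omega_n\}_{n=0}^\infty$, the weighted shift $W_\omega$ is the bounded operator on $\ell^2(\mathbf{Z}_+)$ with $W_\omega e_n:=\omega_n e_{n+1}$ ($n\ge 0$), where $\{e_n\}$ is the canonical orthonormal basis. For $y>0$, $\omega(y)$ is the back-step extension $y,\omega_0,\omega_1,\omega_2,\dots$. For $\ell\ge1$ and $0\le i\le\ell-1$, $\omega(\ell:i)$ is the weight sequence $\{\prod_{m=0}^{\ell-1}\omega_{\ell j+i+m}\}_{j=0}^\infty$; thus $\alpha(\sqrt x)(\ell:0)$ is obtained by applying $(\ell:0)$ to the sequence $\sqrt x,\alpha_0,\alpha_1,\dots$. Positive quadratic hyponormality of $W_\omega$: for $s\in\mathbf{C}$ and $n\ge0$ let $P_n$ be the orthogonal projection onto the span of $e_0,\dots,e_n$ and $D_n(s):=P_n[(W_\omega+sW_\omega^2)^*,W_\omega+sW_\omega^2]P_n$ (where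 $[A,B]:=AB-BA$), viewed as an $(n+1)\times(n+1)$ matrix. It is tridiagonal with diagonal entries $q_0,\dots,q_n$, subdiagonal entries $r_0,\dots,r_{n-1}$ and superdiagonal entries $\bar r_0,\dots,\bar r_{n-1}$, where $q_k:=u_k+|s|^2v_k$, $r_k:=s\sqrt{w_k}$, $u_k:=\omega_k^2-\omega_{k-1}^2$, $v_k:=\omega_k^2\omega_{k+1}^2-\omega_{k-1}^2\omega_{k-2}^2$, $w_k:=\omega_k^2(\omega_{k+1}^2-\omega_{k-1}^2)^2$ ($k\ge0$), with $\omega_{-1}=\omega_{-2}:=0$. Then $\det D_n(s)$ is a polynomial in $t:=|s|^2$ of degree at most $n+1$, written $d_n(t)=\sum_{i=0}^{n+1}c(n,i)t^i$. $W_\omega$ is positively quadratically hyponormal if $c(n,i)\ge0$ for all $n\ge 0$ and $0\le i\le n+1$. *)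

theory Defs
  imports Complex_Main "Jordan_Normal_Form.Determinant"
begin

text \<open>Operators are maps on all complex sequences; only their restriction to the
  Hilbert space \<open>ell2\<close> is relevant.\<close>

type_synonym seq_op = "(nat \<Rightarrow> complex) \<Rightarrow> nat \<Rightarrow> complex"

definition ell2 :: "(nat \<Rightarrow> complex) set" where
  "ell2 = {f. summable (\<lambda>n. (cmod (f n))\<^sup>2)}"

definition ell2_inner :: "(nat \<Rightarrow> complex) \<Rightarrow> (nat \<Rightarrow> complex) \<Rightarrow> complex" where
  "ell2_inner f g = (\<Sum>n. f n * cnj (g n))"

definition ell2_basis :: "nat \<Rightarrow> nat \<Rightarrow> complex" where
  "ell2_basis i = (\<lambda>n. if n = i then 1 else 0)"

definition ell2_adjoint :: "seq_op \<Rightarrow> seq_op" where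
  "ell2_adjoint A g =
     (THE h. h \<in> ell2 \<and> (\<forall>f\<in>ell2. ell2_inner (A f) g = ell2_inner f h))"

definition op_commutator :: "seq_op \<Rightarrow> seq_op \<Rightarrow> seq_op" where
  "op_commutator A B = (\<lambda>f n. A (B f) n - B (A f) n)"

definition initial_projection :: "nat \<Rightarrow> seq_op" where
  "initial_projection n = (\<lambda>f k. if k \<le> n then f k else 0)"

definition compression :: "nat \<Rightarrow> seq_op \<Rightarrow> complex mat" where
  "compression n A = mat (n + 1) (n + 1) (\<lambda>(i, j).
     ell2_inner (initial_projection n (A (initial_projection n (ell2_basis j)))) (ell2_basis i))"

definition weighted_shift :: "(nat \<Rightarrow> real) \<Rightarrow> seq_op" where
  "weighted_shift \<omega> f = (\<lambda>n. case n of 0 \<Rightarrow> 0 | Suc k \<Rightarrow> complex_of_real (\<omega> k) * f k)"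

definition quad_pencil :: "seq_op \<Rightarrow> complex \<Rightarrow> seq_op" where
  "quad_pencil W s = (\<lambda>f n. W f n + s * W (W f) n)"

definition D_mat :: "seq_op \<Rightarrow> nat \<Rightarrow> complex \<Rightarrow> complex mat" where
  "D_mat W n s =
     compression n (op_commutator (ell2_adjoint (quad_pencil W s)) (quad_pencil W s))"

text \<open>The polynomial \<open>d\<^sub>n\<close> in \<open>t = |s|\<^sup>2\<close>. For weighted shifts it exists, is unique, and
  satisfies the expected three-term recursion; see \<open>d_poly_unique\<close> and \<open>d_poly_rec\<close> below.\<close>

definition d_poly :: "seq_op \<Rightarrow> nat \<Rightarrow> real poly" where
  "d_poly W n = (THE p. degree p \<le> n + 1 \<and>
     (\<forall>s. det (D_mat W n s) = complex_of_real (poly p ((cmod s)\<^sup>2))))"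

definition pos_quad_hyponormal :: "seq_op \<Rightarrow> bool" where
  "pos_quad_hyponormal W \<longleftrightarrow> (\<forall>n. \<forall>i\<le>n + 1. coeff (d_poly W n) i \<ge> 0)"

definition back_step :: "real \<Rightarrow> (nat \<Rightarrow> real) \<Rightarrow> nat \<Rightarrow> real" where
  "back_step y \<omega> = (\<lambda>n. case n of 0 \<Rightarrow> y | Suc k \<Rightarrow> \<omega> k)"

definition block_weights :: "(nat \<Rightarrow> real) \<Rightarrow> nat \<Rightarrow> nat \<Rightarrow> nat \<Rightarrow> real" where
  "block_weights \<omega> l i = (\<lambda>j. \<Prod>m<l. \<omega> (l * j + i + m))"

definition \<alpha> :: "nat \<Rightarrow> real" where
  "\<alpha> n = sqrt ((real n + 2) / (real n + 3))"

lemma weighted_shift_basis: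
  "weighted_shift \<omega> (ell2_basis n) = (\<lambda>k. complex_of_real (\<omega> n) * ell2_basis (Suc n) k)"
  by (auto simp: weighted_shift_def ell2_basis_def fun_eq_iff split: nat.splits)

lemma weighted_shift_ell2:
  assumes "Bseq \<omega>" "f \<in> ell2"
  shows "weighted_shift \<omega> f \<in> ell2"
proof -
  obtain B where B: "\<And>n. \<bar>\<omega> n\<bar> \<le> B"
    using assms(1) unfolding Bseq_def by auto
  have "summable (\<lambda>n. B\<^sup>2 * (cmod (f n))\<^sup>2)"
    using assms(2) by (auto simp: ell2_def)
  then have "summable (\<lambda>n. (cmod (complex_of_real (\<omega> n) * f n))\<^sup>2)"
  proof (rule summable_comparison_test_ev[rotated], intro always_eventually allI)
    fix n
    have "\<bar>\<omega> n\<bar>\<^sup>2 \<le> B\<^sup>2" using B[of n] by (intro power_mono) auto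
    then show "norm ((cmod (complex_of_real (\<omega> n) * f n))\<^sup>2) \<le> B\<^sup>2 * (cmod (f n))\<^sup>2"
      by (auto simp: norm_mult power_mult_distrib intro!: mult_right_mono)
  qed
  then have "summable (\<lambda>n. (cmod (weighted_shift \<omega> f (Suc n)))\<^sup>2)"
    by (simp add: weighted_shift_def)
  then show ?thesis unfolding ell2_def using summable_Suc_iff by blast
qed

lemma ell2_inner_basis: "ell2_inner f (ell2_basis i) = f i"
  unfolding ell2_inner_def ell2_basis_def
  by (subst suminf_finite[of "{i}"]) auto

lemma ell2_inner_basis_left: "ell2_inner (ell2_basis i) g = cnj (g i)"
  unfolding ell2_inner_def ell2_basis_def
  by (subst suminf_finite[of "{i}"]) auto

lemma ell2_finite_support:
  assumes "\<And>k. k > N \<Longrightarrow> g k = 0"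
  shows "g \<in> ell2"
  unfolding ell2_def using assms
  by (auto intro!: summable_finite[of "{..N}"]) (meson not_le)

lemma ell2_inner_finite_support:
  assumes "\<And>k. k \<ge> N \<Longrightarrow> g k = 0"
  shows "ell2_inner f g = (\<Sum>n<N. f n * cnj (g n))"
  unfolding ell2_inner_def using assms by (intro suminf_finite) (auto simp: not_less)

lemma ell2_adjoint_eqI:
  assumes "h \<in> ell2" and "\<And>f. f \<in> ell2 \<Longrightarrow> ell2_inner (A f) g = ell2_inner f h"
  shows "ell2_adjoint A g = h"
  unfolding ell2_adjoint_def
proof (rule the_equality)
  fix h' assume h': "h' \<in> ell2 \<and> (\<forall>f\<in>ell2. ell2_inner (A f) g = ell2_inner f h')"
  show "h' = h"
  proof
    fix i
    have "ell2_basis i \<in> ell2"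
      by (rule ell2_finite_support[of i]) (auto simp: ell2_basis_def)
    then have "ell2_inner (ell2_basis i) h' = ell2_inner (ell2_basis i) h"
      using h' assms(2) by metis
    then show "h' i = h i" by (simp add: ell2_inner_basis_left)
  qed
qed (use assms in auto)

lemma quad_pencil_adjoint:
  assumes fin: "\<And>k. k > N \<Longrightarrow> g k = 0"
  shows "ell2_adjoint (quad_pencil (weighted_shift \<omega>) s) g =
    (\<lambda>n. complex_of_real (\<omega> n) * g (n + 1)
       + cnj s * complex_of_real (\<omega> n) * complex_of_real (\<omega> (n + 1)) * g (n + 2))"
    (is "_ = ?h")
proof (rule ell2_adjoint_eqI)
  show "?h \<in> ell2" by (rule ell2_finite_support[of N]) (auto simp: fin)
  fix f
  let ?W = "weighted_shift \<omega>"
  have "ell2_inner (quad_pencil ?W s f) g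
      = (\<Sum>n<Suc (Suc N). quad_pencil ?W s f n * cnj (g n))"
    by (rule ell2_inner_finite_support) (auto simp: fin)
  also have "\<dots> = (\<Sum>n<Suc (Suc N). ?W f n * cnj (g n)) + (\<Sum>n<Suc (Suc N). s * ?W (?W f) n * cnj (g n))"
    by (simp add: quad_pencil_def distrib_right sum.distrib del: sum.lessThan_Suc)
  also have "(\<Sum>n<Suc (Suc N). ?W f n * cnj (g n))
      = (\<Sum>n<Suc N. complex_of_real (\<omega> n) * f n * cnj (g (n + 1)))"
    by (subst sum.lessThan_Suc_shift) (simp add: weighted_shift_def del: sum.lessThan_Suc)
  also have "(\<Sum>n<Suc (Suc N). s * ?W (?W f) n * cnj (g n))
      = (\<Sum>n<N. s * complex_of_real (\<omega> n) * complex_of_real (\<omega> (n + 1)) * f n * cnj (g (n + 2)))"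
    by (subst sum.lessThan_Suc_shift, subst sum.lessThan_Suc_shift)
      (simp add: weighted_shift_def mult_ac del: sum.lessThan_Suc)
  also have "\<dots> = (\<Sum>n<Suc N. s * complex_of_real (\<omega> n) * complex_of_real (\<omega> (n + 1)) * f n * cnj (g (n + 2)))"
    by (simp add: fin)
  also have "(\<Sum>n<Suc N. complex_of_real (\<omega> n) * f n * cnj (g (n + 1))) + \<dots>
      = (\<Sum>n<Suc N. f n * cnj (?h n))"
    unfolding sum.distrib[symmetric] by (intro sum.cong) (auto simp: algebra_simps)
  also have "\<dots> = ell2_inner f ?h"
    by (rule ell2_inner_finite_support[symmetric]) (auto simp: fin)
  finally show "ell2_inner (quad_pencil ?W s f) g = ell2_inner f ?h" .
qed

text \<open>\<open>wt \<omega> k i\<close> is the weight with index \<open>k - i\<close>, which is zero for negative indices.\<close>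

definition wt :: "(nat \<Rightarrow> real) \<Rightarrow> nat \<Rightarrow> nat \<Rightarrow> real" where
  "wt \<omega> k i = (if i \<le> k then \<omega> (k - i) else 0)"

definition u_coef :: "(nat \<Rightarrow> real) \<Rightarrow> nat \<Rightarrow> real" where
  "u_coef \<omega> k = (\<omega> k)\<^sup>2 - (wt \<omega> k 1)\<^sup>2"

definition v_coef :: "(nat \<Rightarrow> real) \<Rightarrow> nat \<Rightarrow> real" where
  "v_coef \<omega> k = (\<omega> k)\<^sup>2 * (\<omega> (k + 1))\<^sup>2 - (wt \<omega> k 1)\<^sup>2 * (wt \<omega> k 2)\<^sup>2"

definition w_coef :: "(nat \<Rightarrow> real) \<Rightarrow> nat \<Rightarrow> real" where
  "w_coef \<omega> k = (\<omega> k)\<^sup>2 * ((\<omega> (k + 1))\<^sup>2 - (wt \<omega> k 1)\<^sup>2)\<^sup>2"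

text \<open>The off-diagonal factor \<open>\<rho> k\<close> is a square root of \<open>w_coef \<omega> k\<close>; it is the nonnegative
  one whenever the weights are nonnegative and \<open>\<omega> (k - 1) \<le> \<omega> (k + 1)\<close>.
  Its sign does not affect the determinant.\<close>

definition D_entry :: "(nat \<Rightarrow> real) \<Rightarrow> complex \<Rightarrow> nat \<Rightarrow> nat \<Rightarrow> complex" where
  "D_entry \<omega> s i j =
    (let \<rho> = (\<lambda>k. complex_of_real (\<omega> k * ((\<omega> (k + 1))\<^sup>2 - (wt \<omega> k 1)\<^sup>2))) in
     if i = j then complex_of_real (u_coef \<omega> i + (cmod s)\<^sup>2 * v_coef \<omega> i)
     else if i = Suc j then s * \<rho> j
     else if j = Suc i then cnj s * \<rho> i
     else 0)"

lemma D_mat_weighted_shift: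
  "D_mat (weighted_shift \<omega>) n s = mat (n + 1) (n + 1) (\<lambda>(i, j). D_entry \<omega> s i j)"
proof (rule eq_matI)
  fix i j
  assume "i < dim_row (mat (n + 1) (n + 1) (\<lambda>(i, j). D_entry \<omega> s i j))"
    and "j < dim_col (mat (n + 1) (n + 1) (\<lambda>(i, j). D_entry \<omega> s i j))"
  then have ij: "i \<le> n" "j \<le> n" by auto
  let ?T = "quad_pencil (weighted_shift \<omega>) s"
  have P: "initial_projection n (ell2_basis j) = ell2_basis j"
    using ij by (auto simp: initial_projection_def ell2_basis_def)
  have adj1: "ell2_adjoint ?T (ell2_basis j) = (\<lambda>n. complex_of_real (\<omega> n) * ell2_basis j (n + 1)
       + cnj s * complex_of_real (\<omega> n) * complex_of_real (\<omega> (n + 1)) * ell2_basis j (n + 2))"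
    by (rule quad_pencil_adjoint[of j]) (auto simp: ell2_basis_def)
  have adj2: "ell2_adjoint ?T (?T (ell2_basis j)) = (\<lambda>n. complex_of_real (\<omega> n) * ?T (ell2_basis j) (n + 1)
       + cnj s * complex_of_real (\<omega> n) * complex_of_real (\<omega> (n + 1)) * ?T (ell2_basis j) (n + 2))"
    by (rule quad_pencil_adjoint[of "j + 2"])
      (auto simp: quad_pencil_def weighted_shift_def ell2_basis_def split: nat.splits)
  have ss: "s * cnj s = complex_of_real ((cmod s)\<^sup>2)"
    by (rule complex_norm_square[symmetric])
  have T_basis: "?T (ell2_basis j) = (\<lambda>n. complex_of_real (\<omega> j) * ell2_basis (j + 1) n
       + s * complex_of_real (\<omega> j) * complex_of_real (\<omega> (j + 1)) * ell2_basis (j + 2) n)"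
    by (auto simp: quad_pencil_def weighted_shift_def ell2_basis_def fun_eq_iff split: nat.splits)
  have T_0: "?T f 0 = 0" and T_1: "?T f (Suc 0) = complex_of_real (\<omega> 0) * f 0"
    and T_2: "?T f (Suc (Suc k)) = complex_of_real (\<omega> (Suc k)) * f (Suc k)
      + s * complex_of_real (\<omega> (Suc k)) * complex_of_real (\<omega> k) * f k" for f k
    by (simp_all add: quad_pencil_def weighted_shift_def)
  have "D_mat (weighted_shift \<omega>) n s $$ (i, j) =
      ell2_adjoint ?T (?T (ell2_basis j)) i - ?T (ell2_adjoint ?T (ell2_basis j)) i"
    using ij by (simp add: D_mat_def compression_def P op_commutator_def ell2_inner_basis)
      (simp add: initial_projection_def)
  also have "\<dots> = D_entry \<omega> s i j"
  proof -
    let ?E = "ell2_adjoint ?T (?T (ell2_basis j)) i - ?T (ell2_adjoint ?T (ell2_basis j)) i"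
    have ss': "s * (cnj s * z) = complex_of_real (cmod s) * (complex_of_real (cmod s) * z)"
      "cnj s * (s * z) = complex_of_real (cmod s) * (complex_of_real (cmod s) * z)" for z
      using ss by (simp_all add: power2_eq_square flip: mult.assoc) (simp add: mult.commute)
    note defs = T_basis T_0 T_1 T_2
    note simps = ell2_basis_def D_entry_def u_coef_def v_coef_def wt_def
      power2_eq_square algebra_simps ss'
    consider "i = 0" | "i = Suc 0" | k where "i = Suc (Suc k)"
      by (metis not0_implies_Suc)
    then show "?E = D_entry \<omega> s i j"
    proof cases
      case 1
      show ?thesis unfolding 1 adj1 adj2 unfolding defs by (auto simp: simps)
    next
      case 2
      show ?thesis unfolding 2 adj1 adj2 unfolding defs by (auto simp: simps)
    next
      case 3
      show ?thesis unfolding 3 adj1 adj2 unfolding defs by (auto simp: simps)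
    qed
  qed
  finally show "D_mat (weighted_shift \<omega>) n s $$ (i, j)
      = mat (n + 1) (n + 1) (\<lambda>(i, j). D_entry \<omega> s i j) $$ (i, j)"
    using ij by simp
qed (auto simp: D_mat_def compression_def)

lemma det_tridiagonal:
  fixes f :: "nat \<Rightarrow> nat \<Rightarrow> 'a :: comm_ring_1"
  assumes z: "\<And>i j. Suc i < j \<or> Suc j < i \<Longrightarrow> f i j = 0"
  shows "det (mat (n + 2) (n + 2) (\<lambda>(i, j). f i j)) =
    f (n + 1) (n + 1) * det (mat (n + 1) (n + 1) (\<lambda>(i, j). f i j))
    - f n (n + 1) * f (n + 1) n * det (mat n n (\<lambda>(i, j). f i j))"
proof -
  let ?A = "\<lambda>n. mat n n (\<lambda>(i, j). f i j)"
  have A: "?A (n + 2) \<in> carrier_mat (n + 2) (n + 2)" by simp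
  let ?B = "mat_delete (?A (n + 2)) (n + 1) n"
  have B: "?B \<in> carrier_mat (n + 1) (n + 1)"
    by (rule carrier_matI) simp_all
  have "det ?B = (\<Sum>i<n + 1. ?B $$ (i, n) * cofactor ?B i n)"
    by (rule laplace_expansion_column[OF B]) simp
  also have "\<dots> = (\<Sum>i\<in>{n}. ?B $$ (i, n) * cofactor ?B i n)"
    by (rule sum.mono_neutral_right) (auto simp: mat_delete_def z)
  also have "mat_delete ?B n n = ?A n"
    by (rule eq_matI) (auto simp: mat_delete_def)
  then have "(\<Sum>i\<in>{n}. ?B $$ (i, n) * cofactor ?B i n) = f n (n + 1) * det (?A n)"
    by (simp add: cofactor_def) (simp add: mat_delete_def)
  finally have detB: "det ?B = f n (n + 1) * det (?A n)" .
  have C: "mat_delete (?A (n + 2)) (n + 1) (n + 1) = ?A (n + 1)"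
    by (rule eq_matI) (auto simp: mat_delete_def)
  have "det (?A (n + 2)) = (\<Sum>j<n + 2. ?A (n + 2) $$ (n + 1, j) * cofactor (?A (n + 2)) (n + 1) j)"
    by (rule laplace_expansion_row[OF A]) simp
  also have "\<dots> = (\<Sum>j\<in>{n, n + 1}. ?A (n + 2) $$ (n + 1, j) * cofactor (?A (n + 2)) (n + 1) j)"
    by (rule sum.mono_neutral_right) (auto simp: z)
  also have "\<dots> = f (n + 1) (n + 1) * det (?A (n + 1)) - f n (n + 1) * f (n + 1) n * det (?A n)"
    using detB C by (simp add: cofactor_def)
  finally show ?thesis .
qed

fun d_rec :: "(nat \<Rightarrow> real) \<Rightarrow> nat \<Rightarrow> real poly" where
  "d_rec \<omega> 0 = [:u_coef \<omega> 0, v_coef \<omega> 0:]"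
| "d_rec \<omega> (Suc 0) = [:u_coef \<omega> 1, v_coef \<omega> 1:] * d_rec \<omega> 0 - [:0, w_coef \<omega> 0:]"
| "d_rec \<omega> (Suc (Suc n)) = [:u_coef \<omega> (n + 2), v_coef \<omega> (n + 2):] * d_rec \<omega> (Suc n)
     - [:0, w_coef \<omega> (n + 1):] * d_rec \<omega> n"

lemma degree_linear: "degree [:a, b:] \<le> 1"
  by (simp add: degree_pCons_le order_trans[OF degree_pCons_le])

lemma degree_d_rec: "degree (d_rec \<omega> n) \<le> n + 1"
proof (induction \<omega> n rule: d_rec.induct)
  case (2 \<omega>)
  have "degree ([:u_coef \<omega> 1, v_coef \<omega> 1:] * d_rec \<omega> 0) \<le> 1 + 1"
    by (rule order_trans[OF degree_mult_le]) (use 2 degree_linear in \<open>intro add_mono\<close>, auto)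
  moreover have "degree [:0, w_coef \<omega> 0:] \<le> 1 + 1"
    using degree_linear[of 0 "w_coef \<omega> 0"] by linarith
  ultimately show ?case by (simp only: d_rec.simps One_nat_def) (intro degree_diff_le, auto)
next
  case (3 \<omega> n)
  have "degree ([:u_coef \<omega> (n + 2), v_coef \<omega> (n + 2):] * d_rec \<omega> (Suc n)) \<le> 1 + (Suc n + 1)"
    by (rule order_trans[OF degree_mult_le add_mono[OF degree_linear 3(1)]])
  moreover have "degree ([:0, w_coef \<omega> (n + 1):] * d_rec \<omega> n) \<le> 1 + (n + 1)"
    by (rule order_trans[OF degree_mult_le add_mono[OF degree_linear 3(2)]])
  ultimately show ?case by (simp only: d_rec.simps) (intro degree_diff_le, auto)
qed (use degree_linear in auto)

lemma det_D_mat: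
  "det (D_mat (weighted_shift \<omega>) n s) = complex_of_real (poly (d_rec \<omega> n) ((cmod s)\<^sup>2))"
proof -
  let ?A = "\<lambda>n. mat n n (\<lambda>(i, j). D_entry \<omega> s i j)"
  have step: "det (?A (n + 2)) =
      complex_of_real (u_coef \<omega> (n + 1) + (cmod s)\<^sup>2 * v_coef \<omega> (n + 1)) * det (?A (n + 1))
      - complex_of_real ((cmod s)\<^sup>2 * w_coef \<omega> n) * det (?A n)" for n
  proof -
    have "D_entry \<omega> s n (n + 1) * D_entry \<omega> s (n + 1) n = (s * cnj s) * complex_of_real (w_coef \<omega> n)"
      by (simp add: D_entry_def w_coef_def power2_eq_square)
    also have "\<dots> = complex_of_real ((cmod s)\<^sup>2 * w_coef \<omega> n)"
      by (simp only: complex_norm_square of_real_mult)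
    finally show ?thesis
      by (subst det_tridiagonal) (auto simp: D_entry_def)
  qed
  have det0: "det (?A 0) = 1" by (rule det_dim_zero) simp
  have det1: "det (?A (Suc 0)) = complex_of_real (u_coef \<omega> 0 + (cmod s)\<^sup>2 * v_coef \<omega> 0)"
    by (subst det_single) (auto simp: D_entry_def)
  have "det (?A (n + 1)) = complex_of_real (poly (d_rec \<omega> n) ((cmod s)\<^sup>2))"
  proof (induction \<omega>'\<equiv>\<omega> n rule: d_rec.induct)
    case 1
    then show ?case by (simp add: det1)
  next
    case 2
    then show ?case using step[of 0] by (simp add: det0 det1 algebra_simps)
  next
    case (3 n)
    then show ?case using step[of "n + 1"] by (simp add: algebra_simps)
  qed
  then show ?thesis unfolding D_mat_weighted_shift .
qed

lemma d_poly_unique: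
  "\<exists>!p. degree p \<le> n + 1 \<and>
     (\<forall>s. det (D_mat (weighted_shift \<omega>) n s) = complex_of_real (poly p ((cmod s)\<^sup>2)))"
proof (rule ex1I[of _ "d_rec \<omega> n"])
  fix p
  assume p: "degree p \<le> n + 1 \<and>
     (\<forall>s. det (D_mat (weighted_shift \<omega>) n s) = complex_of_real (poly p ((cmod s)\<^sup>2)))"
  have "poly (p - d_rec \<omega> n) t = 0" if "t \<ge> 0" for t
  proof -
    have "complex_of_real (poly p ((cmod (of_real (sqrt t)))\<^sup>2))
        = complex_of_real (poly (d_rec \<omega> n) ((cmod (of_real (sqrt t)))\<^sup>2))"
      using p det_D_mat[of \<omega> n "of_real (sqrt t)"] by simp
    then show ?thesis using that by simp
  qed
  then have "{0..} \<subseteq> {t. poly (p - d_rec \<omega> n) t = 0}" by auto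
  then have "infinite {t. poly (p - d_rec \<omega> n) t = 0}"
    using infinite_Ici[of "0::real"] finite_subset by blast
  then show "p = d_rec \<omega> n" using poly_roots_finite[of "p - d_rec \<omega> n"] by auto
qed (use degree_d_rec det_D_mat in blast)

lemma d_poly_rec: "d_poly (weighted_shift \<omega>) n = d_rec \<omega> n"
  unfolding d_poly_def
  by (rule the1_equality[OF d_poly_unique]) (use degree_d_rec det_D_mat in blast)

end

theory Submission
  imports Defs
begin

text \<open>
  The block weights telescope: \<open>\<omega>\<^sub>0\<^sup>2 = y\<close> with \<open>y = 2x / (l + 1)\<close>, and
  \<open>\<omega>\<^sub>n\<^sup>2 = a\<^sub>n / a\<^sub>n\<^sub>+\<^sub>1\<close> for \<open>n \<ge> 1\<close>, where \<open>a\<^sub>n = n l + 1\<close> is an arithmetic progression.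
  So \<open>x\<close> only enters through the first weight, and for weights of this form the products
  \<open>u\<^sub>n\<^sub>+\<^sub>1 v\<^sub>n\<close> and \<open>w\<^sub>n\<close> coincide as soon as they no longer see \<open>\<omega>\<^sub>0\<close>, that is, for \<open>n \<ge> 3\<close>
  (\<open>u_v_eq_w\<close>).

  This equality collapses the three-term recursion of the determinants: the defect
  \<open>d\<^sub>n - t v\<^sub>n d\<^sub>n\<^sub>-\<^sub>1\<close> is multiplied by the positive number \<open>u\<^sub>n\<^sub>+\<^sub>1\<close> when \<open>n\<close> increases
  (\<open>d_rec_Suc_defect\<close>), hence it is always a positive multiple of one cubic polynomial
  (\<open>d_rec_defect\<close>). Consequently \<open>c(n,i)\<close> is a positive multiple of \<open>c(n-1,i-1)\<close> for \<open>i \<ge> 4\<close>, and only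
  the coefficients with \<open>i \<le> 3\<close> and finitely many initial ones have to be examined.
  Because the ratios \<open>v\<^sub>n / u\<^sub>n\<close> telescope too, each coefficient with \<open>i \<le> 3\<close> is, up to a positive factor,
  an affine function of \<open>n\<close>, so its sign for all \<open>n\<close> is decided by its first value
  and its slope.

  The coefficients of \<open>d\<^sub>n / y\<close> are affine in \<open>y\<close> (\<open>d_rec_2\<close>), so every sign condition that
  depends on \<open>y\<close> is a bound for it, in fact an upper one. All follow from three of them:
  \<open>gap \<ge> 0\<close>, which is \<open>u\<^sub>1 \<ge> 0\<close>; \<open>crit \<ge> 0\<close>, which is \<open>c(4,3) \<ge> 0\<close>; and \<open>crit_slope \<ge> 0\<close>,
  which is the slope for \<open>i = 3\<close> (\<open>nonneg_coeffs\<close>). For \<open>l \<le> 2\<close> the first one implies the other two,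
  for \<open>l \<ge> 3\<close> the second one does, and these two are necessary because they are conditions on
  single coefficients. Solving them for \<open>x\<close> gives the two bounds of the theorem.
\<close>

section \<open>Collapse of the three-term recursion\<close>

text \<open>The hypothesis lets \<open>w\<^sub>n\<^sub>+\<^sub>1\<close> in the recursion be replaced by \<open>u\<^sub>n\<^sub>+\<^sub>2 v\<^sub>n\<^sub>+\<^sub>1\<close>, after which
  \<open>u\<^sub>n\<^sub>+\<^sub>2\<close> factors out of everything except the leading term \<open>t v\<^sub>n\<^sub>+\<^sub>2 d\<^sub>n\<^sub>+\<^sub>1\<close>.\<close>

lemma d_rec_Suc_defect:
  assumes "u_coef \<omega> (Suc (Suc n)) * v_coef \<omega> (Suc n) = w_coef \<omega> (Suc n)"
  shows "d_rec \<omega> (Suc (Suc n)) - [:0, v_coef \<omega> (Suc (Suc n)):] * d_rec \<omega> (Suc n)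
    = smult (u_coef \<omega> (Suc (Suc n))) (d_rec \<omega> (Suc n) - [:0, v_coef \<omega> (Suc n):] * d_rec \<omega> n)"
  using assms[symmetric] by (simp add: smult_diff_right algebra_simps)

text \<open>The recursion is applied by hand below; rewriting with it would destroy every
  expression of the form \<open>d_rec \<omega> (n + 3)\<close>.\<close>

declare d_rec.simps [simp del]

lemma coeff_pCons_nonneg:
  fixes c :: "'a :: {zero, order}"
  assumes "c \<ge> 0" "\<And>i. coeff p i \<ge> 0"
  shows "coeff (pCons c p) i \<ge> 0"
  using assms by (simp add: coeff_pCons split: nat.split)

section \<open>The weights\<close>

locale back_step_weights =
  fixes \<omega> :: "nat \<Rightarrow> real" and l y :: real
  assumes l_ge_1: "l \<ge> 1" and y_pos: "y > 0"
    and weight_0_sq: "(\<omega> 0)\<^sup>2 = y"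
    and weight_Suc_sq: "(\<omega> (Suc n))\<^sup>2 = (real (Suc n) * l + 1) / (real (Suc (Suc n)) * l + 1)"
begin

text \<open>The arithmetic progression with \<open>\<omega>\<^sub>n\<^sup>2 = a\<^sub>n / a\<^sub>n\<^sub>+\<^sub>1\<close> for \<open>n \<ge> 1\<close>.\<close>

definition a :: "nat \<Rightarrow> real" where
  "a n = real n * l + 1"

text \<open>The numerator of \<open>u\<^sub>1 = \<omega>\<^sub>1\<^sup>2 - \<omega>\<^sub>0\<^sup>2\<close>. The constant coefficient of every \<open>d\<^sub>n\<close> with
  \<open>n \<ge> 1\<close> is a positive multiple of it.\<close>

definition gap :: real where
  "gap = (1 + l) - (1 + 2 * l) * y"

lemma a_pos: "a n > 0"
  using l_ge_1 by (simp add: a_def add_nonneg_pos)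

lemma a_nonzero [simp]: "a n \<noteq> 0"
  using a_pos[of n] by simp

lemma weight_sq: "(\<omega> (Suc n))\<^sup>2 = a (Suc n) / a (Suc (Suc n))"
  using weight_Suc_sq[of n] by (simp add: a_def)

text \<open>The indices start where \<open>\<omega>\<^sub>0\<close> has dropped out: \<open>u\<^sub>n\<close> and \<open>w\<^sub>n\<close> involve \<open>\<omega>\<^sub>n\<^sub>-\<^sub>1\<close>,
  while \<open>v\<^sub>n\<close> involves \<open>\<omega>\<^sub>n\<^sub>-\<^sub>2\<close>. In all three cases the numerators are differences of
  products of members of an arithmetic progression with equal index sums, hence multiples
  of \<open>l\<^sup>2\<close>.\<close>

lemma u_coef_tail: "u_coef \<omega> (n + 2) = l\<^sup>2 / (a (n + 2) * a (n + 3))"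
proof -
  have "u_coef \<omega> (n + 2) = a (n + 2) / a (n + 3) - a (n + 1) / a (n + 2)"
    using weight_sq[of "n + 1"] weight_sq[of n]
    by (simp add: u_coef_def wt_def numeral_eq_Suc)
  also have "\<dots> = l\<^sup>2 / (a (n + 2) * a (n + 3))"
    using a_pos[of "n + 2"] a_pos[of "n + 3"]
    by (simp add: divide_simps) (simp add: a_def algebra_simps power2_eq_square)
  finally show ?thesis .
qed

lemma v_coef_tail: "v_coef \<omega> (n + 3) = 4 * l\<^sup>2 / (a (n + 3) * a (n + 5))"
proof -
  have "v_coef \<omega> (n + 3) = a (n + 3) / a (n + 5) - a (n + 1) / a (n + 3)"
    using weight_sq[of "n + 2"] weight_sq[of "n + 3"] weight_sq[of "n + 1"] weight_sq[of n]
    by (simp add: v_coef_def wt_def numeral_eq_Suc)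
  also have "\<dots> = 4 * l\<^sup>2 / (a (n + 3) * a (n + 5))"
    using a_pos[of "n + 3"] a_pos[of "n + 5"]
    by (simp add: divide_simps) (simp add: a_def algebra_simps power2_eq_square)
  finally show ?thesis .
qed

lemma w_coef_tail: "w_coef \<omega> (n + 2) = 4 * l ^ 4 / (a (n + 2) * a (n + 3) * (a (n + 4))\<^sup>2)"
proof -
  have "w_coef \<omega> (n + 2) = a (n + 2) / a (n + 3) * (a (n + 3) / a (n + 4) - a (n + 1) / a (n + 2))\<^sup>2"
    using weight_sq[of "n + 2"] weight_sq[of "n + 1"] weight_sq[of n]
    by (simp add: w_coef_def wt_def numeral_eq_Suc)
  also have "a (n + 3) / a (n + 4) - a (n + 1) / a (n + 2) = 2 * l\<^sup>2 / (a (n + 2) * a (n + 4))"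
    using a_pos[of "n + 2"] a_pos[of "n + 4"]
    by (simp add: divide_simps) (simp add: a_def algebra_simps power2_eq_square)
  also have "a (n + 2) / a (n + 3) * (2 * l\<^sup>2 / (a (n + 2) * a (n + 4)))\<^sup>2
      = 4 * l ^ 4 / (a (n + 2) * a (n + 3) * (a (n + 4))\<^sup>2)"
    by (simp add: field_simps power2_eq_square eval_nat_numeral)
  finally show ?thesis .
qed

lemma u_coef_tail_4: "u_coef \<omega> (n + 4) = l\<^sup>2 / (a (n + 4) * a (n + 5))"
  using u_coef_tail[of "n + 2"] by (simp add: numeral_eq_Suc)

lemma u_v_eq_w: "u_coef \<omega> (n + 4) * v_coef \<omega> (n + 3) = w_coef \<omega> (n + 3)"
proof -
  have "w_coef \<omega> (n + 3) = 4 * l ^ 4 / (a (n + 3) * a (n + 4) * (a (n + 5))\<^sup>2)"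
    using w_coef_tail[of "n + 1"] by (simp add: numeral_eq_Suc)
  then show ?thesis
    by (simp add: u_coef_tail_4 v_coef_tail power2_eq_square power4_eq_xxxx mult_ac)
qed

section \<open>The initial determinants\<close>

lemma weight_sq_numeral: "(\<omega> 1)\<^sup>2 = (l + 1) / (2 * l + 1)" "(\<omega> 2)\<^sup>2 = (2 * l + 1) / (3 * l + 1)"
  "(\<omega> 3)\<^sup>2 = (3 * l + 1) / (4 * l + 1)"
  using weight_Suc_sq[of 0] weight_Suc_sq[of 1] weight_Suc_sq[of 2]
  by (simp_all add: numeral_2_eq_2[symmetric] numeral_3_eq_3[symmetric])

lemma head_pos: "l + 1 > 0" "2 * l + 1 > 0" "3 * l + 1 > 0" "4 * l + 1 > 0"
  "5 * l + 1 > 0"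
  using l_ge_1 by auto

lemma d_rec_0: "d_rec \<omega> 0 = smult (y / (2 * l + 1)) [:2 * l + 1, l + 1:]"
  using weight_sq_numeral weight_0_sq head_pos by (simp add: d_rec.simps u_coef_def v_coef_def wt_def)

lemma d_rec_1: "d_rec \<omega> 1 = smult (y / ((2 * l + 1) * (3 * l + 1)))
    [:(3 * l + 1) * gap, (1 + l) * ((1 + 2 * l) - (1 + 3 * l) * y), (1 + l)\<^sup>2:]"
proof -
  have "u_coef \<omega> 1 = gap / (2 * l + 1)"
    "v_coef \<omega> 1 = (l + 1) / (3 * l + 1)"
    "w_coef \<omega> 0 = y * ((l + 1) / (2 * l + 1))\<^sup>2"
  proof -
    have "u_coef \<omega> 1 = (l + 1) / (2 * l + 1) - y"
      using weight_sq_numeral weight_0_sq by (simp add: u_coef_def wt_def)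
    also have "\<dots> = gap / (2 * l + 1)"
      using head_pos by (simp add: gap_def divide_simps)
    finally show "u_coef \<omega> 1 = gap / (2 * l + 1)" .
    have "v_coef \<omega> 1 = (l + 1) / (2 * l + 1) * ((2 * l + 1) / (3 * l + 1))"
      using weight_sq_numeral by (simp add: v_coef_def wt_def numeral_2_eq_2[symmetric])
    also have "\<dots> = (l + 1) / (3 * l + 1)"
      using head_pos by simp
    finally show "v_coef \<omega> 1 = (l + 1) / (3 * l + 1)" .
    show "w_coef \<omega> 0 = y * ((l + 1) / (2 * l + 1))\<^sup>2"
      using weight_sq_numeral weight_0_sq by (simp add: w_coef_def wt_def)
  qed
  then have "d_rec \<omega> 1 = [:gap / (2 * l + 1), (l + 1) / (3 * l + 1):] * d_rec \<omega> 0
     - [:0, y * ((l + 1) / (2 * l + 1))\<^sup>2:]"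
    by (simp add: d_rec.simps)
  also have "\<dots> = smult (y / ((2 * l + 1) * (3 * l + 1)))
    [:(3 * l + 1) * gap, (1 + l) * ((1 + 2 * l) - (1 + 3 * l) * y), (1 + l)\<^sup>2:]"
    unfolding d_rec_0 using head_pos
    by (simp add: divide_simps gap_def) (simp add: algebra_simps power2_eq_square)
  finally show ?thesis .
qed

text \<open>Products of \<open>v\<^sub>2\<close>, \<open>w\<^sub>1\<close> and the coefficients of \<open>d\<^sub>1\<close> are quadratic in \<open>y\<close>, but all
  quadratic terms of \<open>d\<^sub>2 / y\<close> cancel: every coefficient is affine in \<open>y\<close>. Later steps of the
  recursion do not involve \<open>y\<close>, so this is inherited by all determinants, and each sign
  condition is a single bound on \<open>y\<close>.\<close>

lemma d_rec_2: "d_rec \<omega> 2 = smult (y / ((2 * l + 1)\<^sup>2 * (3 * l + 1) * (4 * l + 1)))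
    [:l\<^sup>2 * (4 * l + 1) * gap, 2 * l\<^sup>2 * (2 * l + 1) * gap,
      l\<^sup>2 * (1 + l) * ((3 + 4 * l) - (2 + 4 * l) * y),
      (1 + l)\<^sup>2 * ((1 + 2 * l)\<^sup>2 - (1 + l) * (1 + 4 * l) * y):]"
proof -
  have uvw: "u_coef \<omega> 2 = l\<^sup>2 / ((2 * l + 1) * (3 * l + 1))"
    "v_coef \<omega> 2 = (2 * l + 1) / (4 * l + 1) - (l + 1) / (2 * l + 1) * y"
    "w_coef \<omega> 1 = (l + 1) / (2 * l + 1) * ((2 * l + 1) / (3 * l + 1) - y)\<^sup>2"
    using weight_sq_numeral weight_0_sq head_pos u_coef_tail[of 0]
    by (simp_all add: v_coef_def w_coef_def wt_def a_def numeral_2_eq_2[symmetric] numeral_3_eq_3[symmetric])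
  have "d_rec \<omega> 2 = [:u_coef \<omega> 2, v_coef \<omega> 2:] * d_rec \<omega> 1 - [:0, w_coef \<omega> 1:] * d_rec \<omega> 0"
    by (simp add: d_rec.simps numeral_2_eq_2)
  also have "\<dots> = smult (y / ((2 * l + 1)\<^sup>2 * (3 * l + 1) * (4 * l + 1)))
    [:l\<^sup>2 * (4 * l + 1) * gap, 2 * l\<^sup>2 * (2 * l + 1) * gap,
      l\<^sup>2 * (1 + l) * ((3 + 4 * l) - (2 + 4 * l) * y),
      (1 + l)\<^sup>2 * ((1 + 2 * l)\<^sup>2 - (1 + l) * (1 + 4 * l) * y):]"
    unfolding d_rec_0 d_rec_1 uvw using head_pos
    by (simp add: divide_simps gap_def) (simp add: algebra_simps power2_eq_square)
  finally show ?thesis .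
qed

section \<open>The defect polynomial\<close>

definition defect_scale :: real where
  "defect_scale = y * l\<^sup>2 / ((2 * l + 1)\<^sup>2 * (3 * l + 1)\<^sup>2 * (4 * l + 1))"

definition defect_poly :: "real poly" where
  "defect_poly = smult defect_scale [:l\<^sup>2 * gap, - 2 * l\<^sup>2 * gap, l\<^sup>2 * (1 + l) * (2 * y - 1),
    (1 + l)\<^sup>2 * (1 - (1 + l) * y):]"

text \<open>The term \<open>t v\<^sub>3 d\<^sub>2\<close> cancels against the recursion for \<open>d\<^sub>3\<close>, which leaves
  \<open>u\<^sub>3 d\<^sub>2 - t w\<^sub>2 d\<^sub>1\<close>; the powers of \<open>t\<close> above the third do not occur in it.\<close>

lemma defect_3: "d_rec \<omega> 3 - [:0, v_coef \<omega> 3:] * d_rec \<omega> 2 = defect_poly"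
proof -
  have uw: "u_coef \<omega> 3 = l\<^sup>2 / ((3 * l + 1) * (4 * l + 1))"
    "w_coef \<omega> 2 = 4 * l ^ 4 / ((2 * l + 1) * (3 * l + 1) * (4 * l + 1)\<^sup>2)"
    using u_coef_tail[of "Suc 0"] w_coef_tail[of 0]
    by (simp_all add: a_def numeral_2_eq_2[symmetric] numeral_3_eq_3[symmetric])
  \<comment> \<open>Clearing the denominators of \<open>d\<^sub>1\<close> and \<open>d\<^sub>2\<close> first turns the claim into an identity
    between polynomials with polynomial coefficients.\<close>
  let ?q1 = "[:(3 * l + 1) * gap, (1 + l) * ((1 + 2 * l) - (1 + 3 * l) * y), (1 + l)\<^sup>2:]"
  let ?q2 = "[:l\<^sup>2 * (4 * l + 1) * gap, 2 * l\<^sup>2 * (2 * l + 1) * gap,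
      l\<^sup>2 * (1 + l) * ((3 + 4 * l) - (2 + 4 * l) * y),
      (1 + l)\<^sup>2 * ((1 + 2 * l)\<^sup>2 - (1 + l) * (1 + 4 * l) * y):]"
  let ?p = "[:l\<^sup>2 * gap, - 2 * l\<^sup>2 * gap, l\<^sup>2 * (1 + l) * (2 * y - 1), (1 + l)\<^sup>2 * (1 - (1 + l) * y):]"
  let ?c = "y * l\<^sup>2 / ((2 * l + 1)\<^sup>2 * (3 * l + 1)\<^sup>2 * (4 * l + 1)\<^sup>2)"
  have rec: "d_rec \<omega> 3 = [:u_coef \<omega> 3, v_coef \<omega> 3:] * d_rec \<omega> 2 - [:0, w_coef \<omega> 2:] * d_rec \<omega> 1"
    using d_rec.simps(3)[of \<omega> "Suc 0"]
    by (simp only: numeral_2_eq_2 numeral_3_eq_3 One_nat_def add_Suc_right add_0_right)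
  have "d_rec \<omega> 3 - [:0, v_coef \<omega> 3:] * d_rec \<omega> 2
      = smult (u_coef \<omega> 3) (d_rec \<omega> 2) - smult (w_coef \<omega> 2) ([:0, 1:] * d_rec \<omega> 1)"
    unfolding rec by simp
  also have "\<dots> = smult (u_coef \<omega> 3 * (y / ((2 * l + 1)\<^sup>2 * (3 * l + 1) * (4 * l + 1)))) ?q2
      - smult (w_coef \<omega> 2 * (y / ((2 * l + 1) * (3 * l + 1)))) ([:0, 1:] * ?q1)"
    unfolding d_rec_1 d_rec_2 by (simp only: smult_smult mult_smult_right)
  also have "u_coef \<omega> 3 * (y / ((2 * l + 1)\<^sup>2 * (3 * l + 1) * (4 * l + 1))) = ?c"
    unfolding uw by (simp add: power2_eq_square mult_ac)
  also have "w_coef \<omega> 2 * (y / ((2 * l + 1) * (3 * l + 1))) = ?c * (4 * l\<^sup>2)"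
    unfolding uw by (simp add: power2_eq_square power4_eq_xxxx mult_ac)
  also have "smult ?c ?q2 - smult (?c * (4 * l\<^sup>2)) ([:0, 1:] * ?q1)
      = smult ?c (?q2 - smult (4 * l\<^sup>2) ([:0, 1:] * ?q1))"
    by (simp only: smult_diff_right smult_smult)
  also have "?q2 - smult (4 * l\<^sup>2) ([:0, 1:] * ?q1) = smult (4 * l + 1) ?p"
    by (simp add: gap_def) (simp add: algebra_simps power2_eq_square)
  also have "smult ?c (smult (4 * l + 1) ?p) = defect_poly"
    unfolding defect_poly_def defect_scale_def smult_smult using head_pos
    by (intro arg_cong2[where f = smult] refl) (simp add: power2_eq_square)
  finally show ?thesis .
qed

text \<open>The factor that the defect has picked up between the indices \<open>3\<close> and \<open>n\<close>.\<close>

definition u_prod :: "nat \<Rightarrow> real" where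
  "u_prod n = (\<Prod>k\<in>{4..n}. u_coef \<omega> k)"

lemma u_coef_tail_pos: "u_coef \<omega> (n + 2) > 0"
  unfolding u_coef_tail using l_ge_1 a_pos by (intro divide_pos_pos mult_pos_pos) auto

lemma u_prod_pos: "u_prod n > 0"
  unfolding u_prod_def
proof (rule prod_pos)
  fix k assume "k \<in> {4..n}"
  then have "k = (k - 2) + 2" by (simp only: atLeastAtMost_iff) linarith
  then show "u_coef \<omega> k > 0" using u_coef_tail_pos[of "k - 2"] by metis
qed

lemma u_prod_Suc: "u_prod (n + 4) = u_coef \<omega> (n + 4) * u_prod (n + 3)"
proof -
  have "u_prod (Suc (n + 3)) = u_coef \<omega> (Suc (n + 3)) * u_prod (n + 3)"
    unfolding u_prod_def by (subst atLeastAtMostSuc_conv) auto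
  then show ?thesis by (simp add: numeral_eq_Suc)
qed

lemma d_rec_defect:
  "d_rec \<omega> (n + 3) = [:0, v_coef \<omega> (n + 3):] * d_rec \<omega> (n + 2)
    + smult (u_prod (n + 3)) defect_poly"
proof (induction n)
  case 0
  have "d_rec \<omega> 3 = [:0, v_coef \<omega> 3:] * d_rec \<omega> 2 + defect_poly"
    using defect_3 by (metis add.commute diff_add_cancel)
  then show ?case by (simp only: add_0) (simp add: u_prod_def)
next
  case (Suc n)
  have "d_rec \<omega> (n + 4) - [:0, v_coef \<omega> (n + 4):] * d_rec \<omega> (n + 3)
      = smult (u_coef \<omega> (n + 4)) (d_rec \<omega> (n + 3) - [:0, v_coef \<omega> (n + 3):] * d_rec \<omega> (n + 2))"
    using d_rec_Suc_defect[of \<omega> "n + 2"] u_v_eq_w[of n]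
    by (simp add: numeral_eq_Suc)
  also have "\<dots> = smult (u_coef \<omega> (n + 4)) (smult (u_prod (n + 3)) defect_poly)"
    using Suc.IH by simp
  also have "\<dots> = smult (u_prod (n + 4)) defect_poly"
    by (simp add: u_prod_Suc)
  finally have "d_rec \<omega> (n + 4) = [:0, v_coef \<omega> (n + 4):] * d_rec \<omega> (n + 3) + smult (u_prod (n + 4)) defect_poly"
    by (simp add: algebra_simps)
  moreover have "Suc n + 3 = n + 4" "Suc n + 2 = n + 3" by simp_all
  ultimately show ?case by (simp only:)
qed

section \<open>Coefficients of low degree\<close>

lemma coeff_0: "coeff (d_rec \<omega> (n + 3)) 0 = u_prod (n + 3) * coeff defect_poly 0"
  by (subst d_rec_defect) simp

lemma coeff_Suc: "coeff (d_rec \<omega> (n + 3)) (Suc i)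
    = 4 * l\<^sup>2 / (a (n + 3) * a (n + 5)) * coeff (d_rec \<omega> (n + 2)) i
      + u_prod (n + 3) * coeff defect_poly (Suc i)"
  by (subst d_rec_defect) (simp add: v_coef_tail)

text \<open>Normalising \<open>c(n,i)\<close> by \<open>u_prod n\<close> turns the factor \<open>v\<^sub>n\<close> of the recursion into
  \<open>v\<^sub>n / u\<^sub>n = 4 a\<^sub>n\<^sub>+\<^sub>1 / a\<^sub>n\<^sub>+\<^sub>2\<close>. These ratios telescope, so iterating the recursion produces only
  the one denominator \<open>a\<^sub>n\<^sub>+\<^sub>2\<close>.\<close>

lemma v_mult_u_prod:
  "4 * l\<^sup>2 / (a (n + 4) * a (n + 6)) * u_prod (n + 3)
    = 4 * a (n + 5) / a (n + 6) * u_prod (n + 4)"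
  unfolding u_prod_Suc u_coef_tail_4 by (simp add: field_simps)

lemma defect_scale_pos: "defect_scale > 0"
  unfolding defect_scale_def using y_pos head_pos l_ge_1 by (intro divide_pos_pos mult_pos_pos) auto

lemma coeff_defect_poly:
  "coeff defect_poly 0 = defect_scale * (l\<^sup>2 * gap)"
  "coeff defect_poly 1 = defect_scale * (- 2 * l\<^sup>2 * gap)"
  "coeff defect_poly 2 = defect_scale * (l\<^sup>2 * (1 + l) * (2 * y - 1))"
  "coeff defect_poly 3 = defect_scale * ((1 + l)\<^sup>2 * (1 - (1 + l) * y))"
  by (simp_all add: defect_poly_def numeral_eq_Suc)

lemma coeff_step:
  assumes "coeff (d_rec \<omega> (n + 3)) i = u_prod (n + 3) * defect_scale * X"
  shows "coeff (d_rec \<omega> (n + 4)) (Suc i)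
    = u_prod (n + 4) * (4 * a (n + 5) / a (n + 6) * (defect_scale * X) + coeff defect_poly (Suc i))"
proof -
  have "coeff (d_rec \<omega> (n + 4)) (Suc i)
      = (4 * l\<^sup>2 / (a (n + 4) * a (n + 6)) * u_prod (n + 3)) * (defect_scale * X)
        + u_prod (n + 4) * coeff defect_poly (Suc i)"
  proof -
    have "Suc n + 3 = n + 4" "Suc n + 5 = n + 6" "Suc n + 2 = n + 3" by simp_all
    then show ?thesis using coeff_Suc[of "Suc n" i] assms by (simp only:)
  qed
  then show ?thesis unfolding v_mult_u_prod by (simp add: algebra_simps)
qed

text \<open>The index \<open>n = 0\<close> is computed from \<open>d\<^sub>2\<close>, the others come from the previous coefficient. The
  sequence \<open>a\<close> is arithmetic, so integer combinations of its members contract: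
  here \<open>4 a\<^sub>n\<^sub>+\<^sub>1 - 2 a\<^sub>n\<^sub>+\<^sub>2 = 2 a\<^sub>n\<close>.\<close>

lemma coeff_1: "coeff (d_rec \<omega> (n + 3)) 1
    = u_prod (n + 3) * defect_scale / a (n + 5) * (2 * l\<^sup>2 * gap * a (n + 3))"
proof (cases n)
  case 0
  have "coeff (d_rec \<omega> 3) 1 = 4 * l\<^sup>2 / (a 3 * a 5) * coeff (d_rec \<omega> 2) 0 + coeff defect_poly 1"
    using coeff_Suc[of 0 0] by (simp add: u_prod_def numeral_2_eq_2)
  also have "\<dots> = defect_scale / a 5 * (2 * l\<^sup>2 * gap * a 3)"
    unfolding d_rec_2 coeff_defect_poly using head_pos
    by (simp add: defect_scale_def a_def divide_simps) (simp add: algebra_simps power2_eq_square)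
  finally show ?thesis using 0 by (simp add: u_prod_def)
next
  case (Suc m)
  then have shift: "n + 3 = m + 4" "n + 5 = m + 6" "n + 2 = m + 3" by simp_all
  have "coeff (d_rec \<omega> (m + 4)) 1 = u_prod (m + 4) * (4 * a (m + 5) / a (m + 6) * (defect_scale * (l\<^sup>2 * gap))
      + coeff defect_poly 1)"
    using coeff_step[of m 0 "l\<^sup>2 * gap"] coeff_0[of m] coeff_defect_poly by simp
  also have "\<dots> = u_prod (m + 4) * defect_scale / a (m + 6) * (2 * l\<^sup>2 * gap * a (m + 4))"
  proof -
    have "4 * a (m + 5) / a (m + 6) * (defect_scale * (l\<^sup>2 * gap)) + defect_scale * (- 2 * l\<^sup>2 * gap)
        = defect_scale * l\<^sup>2 * gap * (4 * a (m + 5) - 2 * a (m + 6)) / a (m + 6)"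
      by (simp add: diff_divide_distrib right_diff_distrib)
    also have "4 * a (m + 5) - 2 * a (m + 6) = 2 * a (m + 4)"
      by (simp add: a_def algebra_simps)
    finally show ?thesis unfolding coeff_defect_poly by simp
  qed
  finally show ?thesis unfolding shift .
qed

lemma coeff_2: "coeff (d_rec \<omega> (n + 3)) 2
    = u_prod (n + 3) * defect_scale / a (n + 5)
      * (l\<^sup>2 * (8 * gap * a (n + 2) - (1 + l) * (1 - 2 * y) * a (n + 5)))"
proof (cases n)
  case 0
  have "coeff (d_rec \<omega> 3) 2 = 4 * l\<^sup>2 / (a 3 * a 5) * coeff (d_rec \<omega> 2) 1 + coeff defect_poly 2"
    using coeff_Suc[of 0 1] by (simp add: u_prod_def numeral_2_eq_2)
  also have "\<dots> = defect_scale / a 5 * (l\<^sup>2 * (8 * gap * a 2 - (1 + l) * (1 - 2 * y) * a 5))"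
    unfolding d_rec_2 coeff_defect_poly using head_pos
    by (simp add: defect_scale_def a_def divide_simps) (simp add: algebra_simps power2_eq_square)
  finally show ?thesis using 0 by (simp only: add_0) (simp add: u_prod_def)
next
  case (Suc m)
  then have shift: "n + 3 = m + 4" "n + 5 = m + 6" "n + 2 = m + 3" by simp_all
  have "coeff (d_rec \<omega> (m + 4)) 2 = u_prod (m + 4) * (4 * a (m + 5) / a (m + 6) *
      (defect_scale * (2 * l\<^sup>2 * gap * a (m + 3) / a (m + 5))) + coeff defect_poly 2)"
    using coeff_step[of m 1 "2 * l\<^sup>2 * gap * a (m + 3) / a (m + 5)"] coeff_1[of m]
    by (simp add: numeral_2_eq_2)
  also have "\<dots> = u_prod (m + 4) * defect_scale / a (m + 6)
      * (l\<^sup>2 * (8 * gap * a (m + 3) - (1 + l) * (1 - 2 * y) * a (m + 6)))"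
  proof -
    have "4 * a (m + 5) / a (m + 6) * (defect_scale * (2 * l\<^sup>2 * gap * a (m + 3) / a (m + 5)))
        + defect_scale * (l\<^sup>2 * (1 + l) * (2 * y - 1))
        = defect_scale * (l\<^sup>2 * (8 * gap * a (m + 3) - (1 + l) * (1 - 2 * y) * a (m + 6))) / a (m + 6)"
      by (simp add: diff_divide_distrib right_diff_distrib)
    then show ?thesis unfolding coeff_defect_poly by simp
  qed
  finally show ?thesis unfolding shift .
qed

text \<open>In contrast to the previous two formulas this one is false for \<open>d\<^sub>3\<close>, since the
  quadratic coefficient of \<open>d\<^sub>2\<close> does not fit the pattern of the later ones; hence it starts
  at \<open>d\<^sub>4\<close>, and the cubic coefficient of \<open>d\<^sub>3\<close> is treated separately.\<close>

lemma coeff_3: "coeff (d_rec \<omega> (n + 4)) 3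
    = u_prod (n + 4) * defect_scale / a (n + 6) * ((1 + l)\<^sup>2 * (1 - (1 + l) * y) * a (n + 6)
       - 4 * l\<^sup>2 * (1 + l) * (1 - 2 * y) * a (n + 5) + 32 * l\<^sup>2 * gap * a (n + 2))"
proof -
  have "coeff (d_rec \<omega> (n + 4)) 3 = u_prod (n + 4) * (4 * a (n + 5) / a (n + 6) *
      (defect_scale * (l\<^sup>2 * (8 * gap * a (n + 2) - (1 + l) * (1 - 2 * y) * a (n + 5)) / a (n + 5)))
      + coeff defect_poly 3)"
    using coeff_step[of n 2 "l\<^sup>2 * (8 * gap * a (n + 2) - (1 + l) * (1 - 2 * y) * a (n + 5)) / a (n + 5)"]
      coeff_2[of n]
    by (simp add: numeral_3_eq_3 numeral_2_eq_2)
  also have "\<dots> = u_prod (n + 4) * defect_scale / a (n + 6) * ((1 + l)\<^sup>2 * (1 - (1 + l) * y) * a (n + 6)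
       - 4 * l\<^sup>2 * (1 + l) * (1 - 2 * y) * a (n + 5) + 32 * l\<^sup>2 * gap * a (n + 2))"
  proof -
    have "4 * a (n + 5) / a (n + 6) *
        (defect_scale * (l\<^sup>2 * (8 * gap * a (n + 2) - (1 + l) * (1 - 2 * y) * a (n + 5)) / a (n + 5)))
      = defect_scale * (4 * l\<^sup>2 * (8 * gap * a (n + 2) - (1 + l) * (1 - 2 * y) * a (n + 5))) / a (n + 6)"
      by simp
    moreover have "defect_scale * ((1 + l)\<^sup>2 * (1 - (1 + l) * y))
      = defect_scale * ((1 + l)\<^sup>2 * (1 - (1 + l) * y) * a (n + 6)) / a (n + 6)"
      by simp
    moreover have "4 * l\<^sup>2 * (8 * gap * a (n + 2) - (1 + l) * (1 - 2 * y) * a (n + 5))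
        + (1 + l)\<^sup>2 * (1 - (1 + l) * y) * a (n + 6)
      = (1 + l)\<^sup>2 * (1 - (1 + l) * y) * a (n + 6)
       - 4 * l\<^sup>2 * (1 + l) * (1 - 2 * y) * a (n + 5) + 32 * l\<^sup>2 * gap * a (n + 2)"
      by (simp add: algebra_simps)
    ultimately show ?thesis
      unfolding coeff_defect_poly
      by (simp only: add_divide_distrib[symmetric] distrib_left[symmetric]
          times_divide_eq_left times_divide_eq_right mult.assoc)
  qed
  finally show ?thesis .
qed

text \<open>Initial value and slope, up to the factor \<open>l\<close>, of the affine function of \<open>n\<close> that
  governs \<open>c(n + 4, 3)\<close>.\<close>

definition crit :: real where
  "crit = (1 + l) * (1 + 7 * l + 34 * l^2 + 44 * l^3) - (1 + 9 * l + 45 * l^2 + 99 * l^3 + 94 * l^4) * y"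

definition crit_slope :: real where
  "crit_slope = (1 + 2 * l + 29 * l^2 + 28 * l^3) - (1 + 3 * l + 27 * l^2 + 57 * l^3) * y"

lemma coeff_3_affine: "coeff (d_rec \<omega> (n + 4)) 3
    = u_prod (n + 4) * defect_scale / a (n + 6) * (crit + real n * l * crit_slope)"
proof -
  have "(1 + l)\<^sup>2 * (1 - (1 + l) * y) * a (n + 6)
       - 4 * l\<^sup>2 * (1 + l) * (1 - 2 * y) * a (n + 5) + 32 * l\<^sup>2 * gap * a (n + 2)
    = crit + real n * l * crit_slope"
    by (simp add: a_def gap_def crit_def crit_slope_def algebra_simps power2_eq_square power3_eq_cube power4_eq_xxxx)
  then show ?thesis unfolding coeff_3 by (simp only:)
qed

lemma coeff_2_affine: "coeff (d_rec \<omega> (n + 3)) 2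
    = u_prod (n + 3) * defect_scale / a (n + 5) * (l\<^sup>2 *
    (((7 + 18 * l + 11 * l\<^sup>2) - (6 + 20 * l + 22 * l\<^sup>2) * y)
      + real n * l * (7 * (1 + l) - (6 + 14 * l) * y)))"
proof -
  have "8 * gap * a (n + 2) - (1 + l) * (1 - 2 * y) * a (n + 5)
    = ((7 + 18 * l + 11 * l\<^sup>2) - (6 + 20 * l + 22 * l\<^sup>2) * y) + real n * l * (7 * (1 + l) - (6 + 14 * l) * y)"
    by (simp add: a_def gap_def algebra_simps power2_eq_square)
  then show ?thesis unfolding coeff_2 by (simp only:)
qed

lemma coeff_3_of_d_rec_3: "coeff (d_rec \<omega> 3) 3
    = y * l\<^sup>2 * (1 + l) / ((2 * l + 1)\<^sup>2 * (3 * l + 1)\<^sup>2 * (4 * l + 1) * (5 * l + 1))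
    * ((1 + 6 * l + 17 * l^2 + 16 * l^3) - (1 + 7 * l + 19 * l^2 + 21 * l^3) * y)"
proof -
  have "coeff (d_rec \<omega> 3) 3 = 4 * l\<^sup>2 / (a 3 * a 5) * coeff (d_rec \<omega> 2) 2 + coeff defect_poly 3"
    using coeff_Suc[of 0 2] by (simp add: u_prod_def numeral_3_eq_3 numeral_2_eq_2)
  also have "\<dots> = y * l\<^sup>2 * (1 + l) / ((2 * l + 1)\<^sup>2 * (3 * l + 1)\<^sup>2 * (4 * l + 1) * (5 * l + 1))
    * ((1 + 6 * l + 17 * l^2 + 16 * l^3) - (1 + 7 * l + 19 * l^2 + 21 * l^3) * y)"
    unfolding d_rec_2 coeff_defect_poly using head_pos
    by (simp add: defect_scale_def a_def divide_simps numeral_2_eq_2) (simp add: algebra_simps eval_nat_numeral)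
  finally show ?thesis .
qed

section \<open>Nonnegativity of all coefficients\<close>

text \<open>The condition \<open>gap \<ge> 0\<close> says \<open>y \<le> (1 + l) / (1 + 2 l)\<close>, so it implies any bound of the form
  \<open>q y \<le> p\<close> that holds at this extreme value. The coefficients \<open>p\<close> and \<open>q\<close> are polynomials in
  \<open>l\<close>, and the comparison at the extreme value is one of polynomials whose difference has nonnegative
  coefficients.\<close>

lemma linear_nonneg:
  assumes "gap \<ge> 0" "q \<ge> 0" "q * (1 + l) \<le> p * (1 + 2 * l)"
  shows "p - q * y \<ge> 0"
proof -
  have "(1 + 2 * l) * (p - q * y) = q * gap + (p * (1 + 2 * l) - q * (1 + l))"
    by (simp add: gap_def algebra_simps)
  also have "\<dots> \<ge> 0" using assms by simp
  finally show ?thesis using l_ge_1 by (simp add: zero_le_mult_iff)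
qed

lemma l_powers: "l * l \<ge> 0" "l * (l * l) \<ge> 0" "l * (l * (l * l)) \<ge> 0"
  using l_ge_1 by simp_all

lemma nonneg_coeffs_head:
  assumes gap: "gap \<ge> 0" and "n \<le> 2"
  shows "coeff (d_rec \<omega> n) i \<ge> 0"
proof -
  have pos: "y > 0" "l \<ge> 0" using y_pos l_ge_1 by auto
  have bound_1: "(1 + 2 * l) - (1 + 3 * l) * y \<ge> 0"
    using l_ge_1 l_powers by (intro linear_nonneg gap) (simp_all add: algebra_simps)
  have bound_2: "(3 + 4 * l) - (2 + 4 * l) * y \<ge> 0"
    using l_ge_1 l_powers by (intro linear_nonneg gap) (simp_all add: algebra_simps)
  have bound_3: "(1 + 2 * l)\<^sup>2 - (1 + l) * (1 + 4 * l) * y \<ge> 0"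
    using l_ge_1 l_powers by (intro linear_nonneg gap) (simp_all add: algebra_simps power2_eq_square)
  consider "n = 0" | "n = 1" | "n = 2" using assms(2) by linarith
  then show ?thesis
  proof cases
    case 1
    show ?thesis unfolding 1 d_rec_0 coeff_smult
      by (intro mult_nonneg_nonneg coeff_pCons_nonneg) (use pos in auto)
  next
    case 2
    show ?thesis unfolding 2 d_rec_1 coeff_smult
      by (intro mult_nonneg_nonneg coeff_pCons_nonneg) (use pos gap bound_1 in auto)
  next
    case 3
    show ?thesis unfolding 3 d_rec_2 coeff_smult
      by (intro mult_nonneg_nonneg coeff_pCons_nonneg) (use pos gap bound_2 bound_3 in auto)
  qed
qed

lemma nonneg_coeffs_low:
  assumes gap: "gap \<ge> 0" and crit: "crit \<ge> 0" and crit_slope: "crit_slope \<ge> 0" and "i \<le> 3"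
  shows "coeff (d_rec \<omega> (n + 3)) i \<ge> 0"
proof -
  have scale_nonneg: "u_prod k * defect_scale \<ge> 0" "u_prod k * defect_scale / a m \<ge> 0" for k m
    using u_prod_pos[of k] defect_scale_pos a_pos[of m] by simp_all
  have pos: "y \<ge> 0" "l \<ge> 0" using y_pos l_ge_1 by auto
  consider "i = 0" | "i = 1" | "i = 2" | "i = 3" using assms(4) by linarith
  then show ?thesis
  proof cases
    case 1
    have "coeff (d_rec \<omega> (n + 3)) 0 = u_prod (n + 3) * defect_scale * (l\<^sup>2 * gap)"
      by (simp add: coeff_0 coeff_defect_poly)
    then show ?thesis unfolding 1 using scale_nonneg gap by simp
  next
    case 2
    show ?thesis unfolding 2 coeff_1
      using scale_nonneg gap a_pos[of "n + 3"] by (intro mult_nonneg_nonneg) auto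
  next
    case 3
    have "(7 + 18 * l + 11 * l\<^sup>2) - (6 + 20 * l + 22 * l\<^sup>2) * y \<ge> 0"
      using l_ge_1 l_powers
      by (intro linear_nonneg gap) (simp_all add: algebra_simps power2_eq_square)
    moreover have "7 * (1 + l) - (6 + 14 * l) * y \<ge> 0"
      using l_ge_1 l_powers by (intro linear_nonneg gap) (simp_all add: algebra_simps)
    ultimately show ?thesis unfolding 3 coeff_2_affine
      using pos scale_nonneg by (intro mult_nonneg_nonneg add_nonneg_nonneg) auto
  next
    case 4
    show ?thesis
    proof (cases n)
      case 0
      have "(1 + 6 * l + 17 * l^2 + 16 * l^3) - (1 + 7 * l + 19 * l^2 + 21 * l^3) * y \<ge> 0"
        using l_ge_1 l_powers
        by (intro linear_nonneg gap)
          (simp_all add: algebra_simps power2_eq_square power3_eq_cube)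
      moreover have "y * l\<^sup>2 * (1 + l) / ((2 * l + 1)\<^sup>2 * (3 * l + 1)\<^sup>2 * (4 * l + 1) * (5 * l + 1)) \<ge> 0"
        using pos by (intro divide_nonneg_nonneg mult_nonneg_nonneg) auto
      ultimately show ?thesis unfolding 4 0 add_0 coeff_3_of_d_rec_3 by (rule mult_nonneg_nonneg[rotated])
    next
      case (Suc m)
      then have "n + 3 = m + 4" by simp
      then show ?thesis unfolding 4 using coeff_3_affine[of m] pos scale_nonneg crit crit_slope
        by (simp only:) (intro mult_nonneg_nonneg add_nonneg_nonneg, auto)
    qed
  qed
qed

text \<open>The defect has degree at most three, so it does not contribute here.\<close>

lemma coeff_high:
  assumes "i \<ge> 3"
  shows "coeff (d_rec \<omega> (n + 3)) (Suc i) = 4 * l\<^sup>2 / (a (n + 3) * a (n + 5)) * coeff (d_rec \<omega> (n + 2)) i"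
proof -
  have "coeff defect_poly (Suc i) = 0"
    using assms by (auto simp: defect_poly_def coeff_pCons split: nat.split)
  then show ?thesis by (simp add: coeff_Suc)
qed

lemma nonneg_coeffs_tail:
  assumes "gap \<ge> 0" "crit \<ge> 0" "crit_slope \<ge> 0"
  shows "coeff (d_rec \<omega> (n + 2)) i \<ge> 0"
proof (induction n arbitrary: i)
  case 0
  show ?case using nonneg_coeffs_head[OF assms(1)] by simp
next
  case (Suc n)
  have *: "Suc n + 2 = n + 3" by simp
  show ?case
  proof (cases "i \<le> 3")
    case True
    then show ?thesis unfolding * using nonneg_coeffs_low assms by blast
  next
    case False
    then obtain j where j: "i = Suc j" "j \<ge> 3" by (cases i) auto
    show ?thesis unfolding * j coeff_high[OF j(2)]
      using Suc a_pos[of "n + 3"] a_pos[of "n + 5"] by (intro mult_nonneg_nonneg) simp_all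
  qed
qed

lemma nonneg_coeffs:
  assumes "gap \<ge> 0" "crit \<ge> 0" "crit_slope \<ge> 0"
  shows "coeff (d_rec \<omega> n) i \<ge> 0"
proof (cases "n \<le> 2")
  case True
  then show ?thesis using nonneg_coeffs_head assms by blast
next
  case False
  then have "n = (n - 2) + 2" by linarith
  then show ?thesis using nonneg_coeffs_tail assms by metis
qed

section \<open>The decisive conditions\<close>

lemma gap_nonneg_if_coeff_nonneg:
  assumes "coeff (d_rec \<omega> 1) 0 \<ge> 0" shows "gap \<ge> 0"
  using assms y_pos head_pos unfolding d_rec_1
  by (simp add: zero_le_mult_iff zero_le_divide_iff)

lemma crit_nonneg_if_coeff_nonneg:
  assumes "coeff (d_rec \<omega> 4) 3 \<ge> 0" shows "crit \<ge> 0"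
proof -
  have "u_prod 4 * defect_scale / a 6 > 0" using u_prod_pos defect_scale_pos a_pos by simp
  moreover have "coeff (d_rec \<omega> 4) 3 = u_prod 4 * defect_scale / a 6 * crit" using coeff_3_affine[of 0] by simp
  ultimately show ?thesis using assms mult_pos_neg[of "u_prod 4 * defect_scale / a 6" crit] by linarith
qed

text \<open>For these two values the bounds on \<open>y\<close> are \<open>2/3\<close> against \<open>43/62\<close> and \<open>15/22\<close>, respectively
  \<open>3/5\<close> against \<open>1509/2495\<close> and \<open>345/571\<close>, so hyponormality of the first step is the strongest one.\<close>

lemma crit_crit_slope_nonneg_small:
  assumes "l = 1 \<or> l = 2" and "gap \<ge> 0"
  shows "crit \<ge> 0 \<and> crit_slope \<ge> 0"
  using assms unfolding crit_def crit_slope_def gap_def by (elim disjE) simp_all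

text \<open>Eliminating \<open>y\<close> with the bound contained in \<open>crit \<ge> 0\<close> leaves a polynomial in \<open>l\<close>
  for each of the other two bounds. Both have a root between \<open>2\<close> and \<open>3\<close>; the Taylor expansion at
  \<open>l = 3\<close> has only positive coefficients.\<close>

lemma gap_crit_slope_nonneg_large:
  assumes "l \<ge> 3" and "crit \<ge> 0"
  shows "gap \<ge> 0 \<and> crit_slope \<ge> 0"
proof -
  define t where "t = l - 3"
  have t: "t \<ge> 0" "l = t + 3" using assms by (simp_all add: t_def)
  let ?B = "1 + 9 * l + 45 * l^2 + 99 * l^3 + 94 * l^4"
  have B: "?B > 0" using assms by (intro add_pos_nonneg) auto
  have "6 * l\<^sup>2 - 13 * l - 3 = 6 * t\<^sup>2 + 23 * t + 12"
    unfolding t(2) by (simp add: algebra_simps power2_eq_square)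
  then have "6 * l\<^sup>2 - 13 * l - 3 \<ge> 0" using t(1) by simp
  then have "(1 + 2 * l) * crit + (1 + l) * l\<^sup>2 * (6 * l\<^sup>2 - 13 * l - 3) \<ge> 0"
    using assms by (intro add_nonneg_nonneg mult_nonneg_nonneg) auto
  also have "\<dots> = ?B * gap"
    unfolding gap_def crit_def
    by (simp add: algebra_simps power2_eq_square power3_eq_cube power4_eq_xxxx)
  finally have "gap \<ge> 0" using B by (simp add: zero_le_mult_iff)
  have taylor: "1 + 2 * l - 64 * l^2 - 34 * l^3 + 31 * l^4
      = 31 * t^4 + 338 * t^3 + 1304 * t^2 + 2048 * t + 1024"
    unfolding t(2) by (simp add: algebra_simps power2_eq_square power3_eq_cube power4_eq_xxxx)
  have "1 + 2 * l - 64 * l^2 - 34 * l^3 + 31 * l^4 \<ge> 0"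
    unfolding taylor using t(1) by simp
  then have "(1 + 3 * l + 27 * l^2 + 57 * l^3) * crit
      + 4 * l^3 * (1 + 2 * l - 64 * l^2 - 34 * l^3 + 31 * l^4) \<ge> 0"
    using assms by (intro add_nonneg_nonneg[OF mult_nonneg_nonneg mult_nonneg_nonneg]) auto
  also have "\<dots> = ?B * crit_slope"
    unfolding crit_slope_def crit_def
    by (simp add: algebra_simps power2_eq_square power3_eq_cube power4_eq_xxxx)
  finally have "crit_slope \<ge> 0" using B by (simp add: zero_le_mult_iff)
  with \<open>gap \<ge> 0\<close> show ?thesis by simp
qed

end

section \<open>The block weights of the back-step extension\<close>

lemma back_step_Suc: "back_step y \<omega> (Suc n) = \<omega> n"
  by (simp add: back_step_def)

lemma prod_telescope_ratio:
  fixes c :: real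
  assumes "c \<ge> 1"
  shows "(\<Prod>m<n. (c + real m) / (c + real m + 1)) = c / (c + real n)"
proof (induction n)
  case (Suc n)
  have "c + real n \<noteq> 0" using assms by linarith
  then show ?case using Suc by (simp add: add_ac)
qed (use assms in simp)

text \<open>The squared weights of the back-step extension are \<open>x\<close> and then \<open>(k + 2) / (k + 3)\<close>, so the
  product over each block telescopes. Only the first block contains \<open>x\<close>; its other \<open>l - 1\<close>
  factors contribute \<open>2 / (l + 1)\<close>.\<close>

lemma block_weights_sq:
  assumes "l \<ge> 1" "x > 0"
  shows "(block_weights (back_step (sqrt x) \<alpha>) l 0 0)\<^sup>2 = 2 * x / (real l + 1)"
    and "(block_weights (back_step (sqrt x) \<alpha>) l 0 (Suc j))\<^sup>2
      = (real (Suc j) * real l + 1) / (real (Suc (Suc j)) * real l + 1)"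
proof -
  let ?\<beta> = "back_step (sqrt x) \<alpha>"
  have \<beta>: "(?\<beta> (Suc k))\<^sup>2 = (2 + real k) / (2 + real k + 1)" for k
    by (simp add: back_step_Suc \<alpha>_def add_ac)
  obtain l' where l': "l = Suc l'" using assms by (cases l) auto
  have "(block_weights ?\<beta> l 0 0)\<^sup>2 = (\<Prod>m<l. (?\<beta> m)\<^sup>2)"
    by (simp add: block_weights_def prod_power_distrib)
  also have "\<dots> = x * (\<Prod>m<l'. (2 + real m) / (2 + real m + 1))"
    unfolding l' prod.lessThan_Suc_shift \<beta> using assms by (simp add: back_step_def)
  also have "\<dots> = 2 * x / (real l + 1)"
    using prod_telescope_ratio[of 2 l'] by (simp add: l' add_ac)
  finally show "(block_weights ?\<beta> l 0 0)\<^sup>2 = 2 * x / (real l + 1)" .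
  let ?N = "l * Suc j"
  have "(block_weights ?\<beta> l 0 (Suc j))\<^sup>2 = (\<Prod>m<l. (?\<beta> (?N + m))\<^sup>2)"
    by (simp add: block_weights_def prod_power_distrib)
  also have "\<dots> = (\<Prod>m<l. (real ?N + 1 + real m) / (real ?N + 1 + real m + 1))"
  proof (rule prod.cong[OF refl])
    fix m
    have "?N + m = Suc (?N + m - 1)" using assms by simp
    moreover have "real (?N + m - 1) = real ?N + real m - 1" using assms by (simp add: of_nat_diff)
    ultimately show "(?\<beta> (?N + m))\<^sup>2 = (real ?N + 1 + real m) / (real ?N + 1 + real m + 1)"
      using \<beta>[of "?N + m - 1"] by (simp only:) (simp add: add_ac)
  qed
  also have "\<dots> = (real ?N + 1) / (real ?N + 1 + real l)"
    by (rule prod_telescope_ratio) simp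
  also have "\<dots> = (real (Suc j) * real l + 1) / (real (Suc (Suc j)) * real l + 1)"
    by (simp add: algebra_simps)
  finally show "(block_weights ?\<beta> l 0 (Suc j))\<^sup>2
      = (real (Suc j) * real l + 1) / (real (Suc (Suc j)) * real l + 1)" .
qed

section \<open>The characterisation\<close>

theorem theorem5p4:
  fixes l :: nat and x :: real
  assumes "l \<ge> 1" and "x > 0"
  shows "pos_quad_hyponormal (weighted_shift (block_weights (back_step (sqrt x) \<alpha>) l 0)) \<longleftrightarrow>
    x \<le> (if l \<le> 2 then (real l + 1)^2 / (2 * (2 * real l + 1))
         else ((real l + 1)^2 * (1 + 7 * real l + 34 * real l^2 + 44 * real l^3))
              / (2 * (1 + 9 * real l + 45 * real l^2 + 99 * real l^3 + 94 * real l^4)))"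
proof -
  let ?\<omega> = "block_weights (back_step (sqrt x) \<alpha>) l 0"
  define y where "y = 2 * x / (real l + 1)"
  interpret back_step_weights ?\<omega> "real l" y
    using assms block_weights_sq[OF assms] by unfold_locales (auto simp: y_def)
  have x: "x = (real l + 1) * y / 2" by (simp add: y_def)
  have pqh: "pos_quad_hyponormal (weighted_shift ?\<omega>) \<longleftrightarrow> (\<forall>n. \<forall>i\<le>n + 1. coeff (d_rec ?\<omega> n) i \<ge> 0)"
    by (simp add: pos_quad_hyponormal_def d_poly_rec)
  show ?thesis
  proof (cases "l \<le> 2")
    case True
    have "(real l + 1)^2 / (2 * (2 * real l + 1)) - x = (real l + 1) / (2 * (2 * real l + 1)) * gap"
      unfolding x gap_def using head_pos
      by (simp add: divide_simps) (simp add: algebra_simps power2_eq_square)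
    moreover have "(real l + 1) / (2 * (2 * real l + 1)) > 0" by simp
    ultimately have "x \<le> (real l + 1)^2 / (2 * (2 * real l + 1)) \<longleftrightarrow> gap \<ge> 0"
      by (smt (verit) mult_nonneg_nonneg mult_pos_neg)
    moreover have "crit \<ge> 0 \<and> crit_slope \<ge> 0" if "gap \<ge> 0"
    proof -
      have "l = 1 \<or> l = 2" using True assms(1) by linarith
      then have "real l = 1 \<or> real l = 2" by auto
      then show ?thesis using crit_crit_slope_nonneg_small that by blast
    qed
    moreover have "gap \<ge> 0" if "\<forall>n. \<forall>i\<le>n + 1. coeff (d_rec ?\<omega> n) i \<ge> 0"
      using gap_nonneg_if_coeff_nonneg that by blast
    ultimately show ?thesis
      unfolding pqh if_P[OF True] using nonneg_coeffs by blast
  next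
    case False
    then have l3: "real l \<ge> 3" by simp
    let ?A = "1 + 7 * real l + 34 * real l^2 + 44 * real l^3"
    let ?B = "1 + 9 * real l + 45 * real l^2 + 99 * real l^3 + 94 * real l^4"
    have B: "?B > 0" using l3 by (intro add_pos_nonneg) auto
    have "(real l + 1)^2 * ?A / (2 * ?B) - x = (real l + 1) / (2 * ?B) * crit"
    proof -
      have "crit = (real l + 1) * ?A - ?B * y" by (simp add: crit_def add.commute)
      then show ?thesis
        unfolding x using B by (simp add: divide_simps) (simp add: algebra_simps power2_eq_square)
    qed
    moreover have "(real l + 1) / (2 * ?B) > 0" using B by simp
    ultimately have "x \<le> (real l + 1)^2 * ?A / (2 * ?B) \<longleftrightarrow> crit \<ge> 0"
      by (smt (verit) mult_nonneg_nonneg mult_pos_neg)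
    moreover have "gap \<ge> 0 \<and> crit_slope \<ge> 0" if "crit \<ge> 0"
      using gap_crit_slope_nonneg_large[OF l3 that] by blast
    moreover have "crit \<ge> 0" if "\<forall>n. \<forall>i\<le>n + 1. coeff (d_rec ?\<omega> n) i \<ge> 0"
      using that by (intro crit_nonneg_if_coeff_nonneg) simp
    ultimately show ?thesis
      unfolding pqh if_not_P[OF False] using nonneg_coeffs by blast
  qed
qed

end
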